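(* $\mathbf{GR}^\circ$ enjoys Lyndon interpolation property. Moreover, for all $\mathcal{L}_2$-formulas $A$ and $B$, if $\mathbf{GR}^\circ\vdash A\to B$, then there exists an $\mathcal{L}_2$-formula $C$ with $v^+(C)\subseteq v^+(A)\cap v^+(B)$, $v^-(C)\subseteq v^-(A)\cap v^-(B)$, $\mathbf{GR}^\circ\vdash A\to C$ and $\mathbf{GR}^\circ\vdash C\to B$, which additionally satisfies: for each $*\in\{+,-\}$ and each $\mathcal{L}_2$-formula $D$, if $\blacksquare D\in S^*(C)$ then $\blacksquare D\in S^*(A)\cap S^*(B)$.
   Context: $\mathcal{L}_2$ is the bimodal propositional language with countably many propositional variables, $\bot$, connectives $\neg,\vee$ (others defined), and unary modal operators $\Box,\blacksquare$; $\Diamond$ abbreviates $\neg\Box\neg$. The logic $\mathbf{GR}^-$ has as axioms all propositional tautologies of $\mathcal{L}_2$ and all instances of $\Box(A\to B)\to(\Box A\to\Box B)$, $\Box(\Box A\to A)\to\Box A$, $\blacksquare A\to\Box A$, $\Box A\to\Box\blacksquare A$, $\Box A\to(\Box\bot\vee\blacksquare A)$, $\Diamond\blacksquare A\to\Diamond A$, and rules modus ponens and $\Box$-necessitation. $\mathbf{GR}^\circ$ is $\mathbf{GR}^-$ plus the rule: from $A$ infer $\blacksquare A$. Positive and negative subformulas: $S^+(A)=\{A\}$ and $S^-(A)=\emptyset$ if $A$ is a variable or $\bot$; $S^+(B\vee C)=S^+(B)\cup S^+(C)\cup\{B\vee C\}$, $S^-(B\vee C)=S^-(B)\cup S^-(C)$;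 $S^+(\neg B)=S^-(B)\cup\{\neg B\}$, $S^-(\neg B)=S^+(B)$; for $\circledast\in\{\Box,\blacksquare\}$, $S^+(\circledast B)=S^+(B)\cup\{\circledast B\}$, $S^-(\circledast B)=S^-(B)$. $v(A)$ is the set of variables occurring in $A$ and $v^*(A)=S^*(A)\cap v(A)$ for $*\in\{+,-\}$. A logic $L$ has Lyndon interpolation property if whenever $L\vdash A\to B$ there is $C$ with $v^*(C)\subseteq v^*(A)\cap v^*(B)$ for $*\in\{+,-\}$, $L\vdash A\to C$ and $L\vdash C\to B$. *)

theory Defs
  imports Main
begin

datatype fm =
    Var nat
  | Bot
  | Neg fm  ("\<^bold>\<not> _" [80] 80)
  | Or fm fm  (infixr "\<^bold>\<or>" 60)
  | Box fm
  | BBox fm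

abbreviation Imp :: "fm \<Rightarrow> fm \<Rightarrow> fm"  (infixr "\<^bold>\<rightarrow>" 55) where
  "A \<^bold>\<rightarrow> B \<equiv> \<^bold>\<not> A \<^bold>\<or> B"

abbreviation Dia :: "fm \<Rightarrow> fm" where
  "Dia A \<equiv> \<^bold>\<not> (Box (\<^bold>\<not> A))"

text \<open>Boolean evaluation: modal formulas are treated as atoms, so that the valuation
  assigns truth values independently to variables and to formulas \<open>Box A\<close>, \<open>BBox A\<close>.\<close>

primrec truth :: "(fm \<Rightarrow> bool) \<Rightarrow> fm \<Rightarrow> bool" where
  "truth V (Var p) = V (Var p)"
| "truth V Bot = False"
| "truth V (\<^bold>\<not> A) = (\<not> truth V A)"
| "truth V (A \<^bold>\<or> B) = (truth V A \<or> truth V B)"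
| "truth V (Box A) = V (Box A)"
| "truth V (BBox A) = V (BBox A)"

definition tautology :: "fm \<Rightarrow> bool" where
  "tautology A \<longleftrightarrow> (\<forall>V. truth V A)"

inductive GR_axiom :: "fm \<Rightarrow> bool" where
  taut: "tautology A \<Longrightarrow> GR_axiom A"
| K: "GR_axiom (Box (A \<^bold>\<rightarrow> B) \<^bold>\<rightarrow> (Box A \<^bold>\<rightarrow> Box B))"
| Loeb: "GR_axiom (Box (Box A \<^bold>\<rightarrow> A) \<^bold>\<rightarrow> Box A)"
| BBox_Box: "GR_axiom (BBox A \<^bold>\<rightarrow> Box A)"
| Box_Box_BBox: "GR_axiom (Box A \<^bold>\<rightarrow> Box (BBox A))"
| Box_Bot_BBox: "GR_axiom (Box A \<^bold>\<rightarrow> (Box Bot \<^bold>\<or> BBox A))"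
| Dia_BBox: "GR_axiom (Dia (BBox A) \<^bold>\<rightarrow> Dia A)"

inductive GR_minus :: "fm \<Rightarrow> bool" where
  ax: "GR_axiom A \<Longrightarrow> GR_minus A"
| mp: "\<lbrakk>GR_minus (A \<^bold>\<rightarrow> B); GR_minus A\<rbrakk> \<Longrightarrow> GR_minus B"
| nec: "GR_minus A \<Longrightarrow> GR_minus (Box A)"

inductive GR_circ :: "fm \<Rightarrow> bool" where
  ax: "GR_axiom A \<Longrightarrow> GR_circ A"
| mp: "\<lbrakk>GR_circ (A \<^bold>\<rightarrow> B); GR_circ A\<rbrakk> \<Longrightarrow> GR_circ B"
| nec: "GR_circ A \<Longrightarrow> GR_circ (Box A)"
| bnec: "GR_circ A \<Longrightarrow> GR_circ (BBox A)"

datatype sign = Plus | Minus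

fun subfms :: "sign \<Rightarrow> fm \<Rightarrow> fm set" where
  "subfms Plus (Var p) = {Var p}"
| "subfms Minus (Var p) = {}"
| "subfms Plus Bot = {Bot}"
| "subfms Minus Bot = {}"
| "subfms Plus (B \<^bold>\<or> C) = subfms Plus B \<union> subfms Plus C \<union> {B \<^bold>\<or> C}"
| "subfms Minus (B \<^bold>\<or> C) = subfms Minus B \<union> subfms Minus C"
| "subfms Plus (\<^bold>\<not> B) = subfms Minus B \<union> {\<^bold>\<not> B}"
| "subfms Minus (\<^bold>\<not> B) = subfms Plus B"
| "subfms Plus (Box B) = subfms Plus B \<union> {Box B}"
| "subfms Minus (Box B) = subfms Minus B"
| "subfms Plus (BBox B) = subfms Plus B \<union> {BBox B}"
| "subfms Minus (BBox B) = subfms Minus B"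

text \<open>Variables are collected as formulas, so that they can be intersected with
  sets of signed subformulas.\<close>

primrec vars :: "fm \<Rightarrow> fm set" where
  "vars (Var p) = {Var p}"
| "vars Bot = {}"
| "vars (\<^bold>\<not> A) = vars A"
| "vars (A \<^bold>\<or> B) = vars A \<union> vars B"
| "vars (Box A) = vars A"
| "vars (BBox A) = vars A"

definition svars :: "sign \<Rightarrow> fm \<Rightarrow> fm set" where
  "svars s A = subfms s A \<inter> vars A"

definition lyndon_interpolation :: "(fm \<Rightarrow> bool) \<Rightarrow> bool" where
  "lyndon_interpolation L \<longleftrightarrow>
    (\<forall>A B. L (A \<^bold>\<rightarrow> B) \<longrightarrow>
      (\<exists>C. (\<forall>s. svars s C \<subseteq> svars s A \<inter> svars s B) \<and> L (A \<^bold>\<rightarrow> C) \<and> L (C \<^bold>\<rightarrow> B)))"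

end

theory Submission
  imports Defs
begin

text \<open>
  Suppose \<open>A \<^bold>\<rightarrow> B\<close> has no interpolant. The worlds of a countermodel are the maximal pairs of
  theories, one for each of the sides \<open>A\<close> and \<open>\<^bold>\<not> B\<close>, that no formula of the common signed
  language separates. Each theory decides every formula, whereas the truth lemma is claimed only
  for formulas occurring with the appropriate sign in the respective side; this is what makes
  Loeb's axiom compatible with signs. A successor keeps the boxed formulas and gains at least
  one from a fixed finite set, so accessibility is conversely well-founded. At a world with
  successors \<open>BBox D\<close> must agree with \<open>Box D\<close>. At a dead end \<open>BBox D\<close> is true if a theory
  demands it at a positive occurrence or if some predecessor forces \<open>Box D\<close>; the axioms
  \<open>Box D \<^bold>\<rightarrow> Box (BBox D)\<close> and \<open>Dia (BBox D) \<^bold>\<rightarrow> Dia D\<close> guarantee that these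
  requirements never clash with the theories.
\<close>

section \<open>Signed subformulas\<close>

primrec flip :: "sign \<Rightarrow> sign" where
  "flip Plus = Minus"
| "flip Minus = Plus"

lemma flip_flip [simp]: "flip (flip s) = s"
  by (cases s) auto

text \<open>The formulas whose signed occurrences an interpolant must share with both sides.
  \<open>Bot\<close>, Boolean connectives and \<open>Box\<close> stay free, so separators can be
  combined by them.\<close>

primrec atomlike :: "fm \<Rightarrow> bool" where
  "atomlike (Var p) = True"
| "atomlike Bot = False"
| "atomlike (\<^bold>\<not> A) = False"
| "atomlike (A \<^bold>\<or> B) = False"
| "atomlike (Box A) = False"
| "atomlike (BBox A) = True"

lemma atomlike_subfms_simps:
  assumes "atomlike D"
  shows "D \<notin> subfms s Bot"
    and "D \<in> subfms s (\<^bold>\<not> A) \<longleftrightarrow> D \<in> subfms (flip s) A"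
    and "D \<in> subfms s (A \<^bold>\<or> B) \<longleftrightarrow> D \<in> subfms s A \<or> D \<in> subfms s B"
    and "D \<in> subfms s (Box A) \<longleftrightarrow> D \<in> subfms s A"
  using assms by (cases s; auto)+

lemma self_subfms [simp]: "A \<in> subfms Plus A"
  by (cases A) auto

text \<open>Signs compose like parities of negations. Both halves go through one induction because
  the negation case exchanges them.\<close>

lemma subfms_trans:
  "(X \<in> subfms Plus A \<longrightarrow> subfms s X \<subseteq> subfms s A) \<and>
   (X \<in> subfms Minus A \<longrightarrow> subfms s X \<subseteq> subfms (flip s) A)"
proof (induction A arbitrary: s)
  case (Neg A)
  show ?case using Neg[of s] Neg[of "flip s"] by (cases s) auto
next
  case (Or A B)
  show ?case using Or(1)[of s] Or(2)[of s] by (cases s) auto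
next
  case (Box A)
  show ?case using Box[of s] by (cases s) auto
next
  case (BBox A)
  show ?case using BBox[of s] by (cases s) auto
qed (cases s; auto)+

lemma subfms_transI:
  "X \<in> subfms s A \<Longrightarrow> Y \<in> subfms Plus X \<Longrightarrow> Y \<in> subfms s A"
  "X \<in> subfms s A \<Longrightarrow> Y \<in> subfms Minus X \<Longrightarrow> Y \<in> subfms (flip s) A"
  using subfms_trans[of X A Plus] subfms_trans[of X A Minus] by (cases s; auto)+

lemma finite_subfms: "finite (subfms s A)"
  by (induction A arbitrary: s) (case_tac s; simp)+

lemma Var_subfms_in_vars: "Var p \<in> subfms s A \<Longrightarrow> Var p \<in> vars A"
  by (induction A arbitrary: s) (case_tac s; auto)+

text \<open>Turns the condition on variables into a special case of the condition on
  \<open>atomlike\<close> subformulas.\<close>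

lemma svars_eq: "svars s A = {X \<in> subfms s A. X \<in> range Var}"
proof -
  have "vars A \<subseteq> range Var" by (induction A) auto
  then show ?thesis unfolding svars_def using Var_subfms_in_vars by blast
qed

section \<open>Derivability from a set of formulas\<close>

text \<open>Local consequence: both necessitation rules act only on theorems, inside
  \<open>base\<close>, so the deduction theorem holds.\<close>

inductive prov :: "fm set \<Rightarrow> fm \<Rightarrow> bool" for G where
  base: "GR_circ X \<Longrightarrow> prov G X"
| hyp: "X \<in> G \<Longrightarrow> prov G X"
| mp: "prov G (X \<^bold>\<rightarrow> Y) \<Longrightarrow> prov G X \<Longrightarrow> prov G Y"

lemma GR_circ_taut: "tautology X \<Longrightarrow> GR_circ X"
  by (intro GR_circ.ax GR_axiom.taut)

lemma prov_taut1:
  "prov G X \<Longrightarrow> tautology (X \<^bold>\<rightarrow> Y) \<Longrightarrow> prov G Y"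
  by (meson GR_circ_taut prov.mp prov.base)

lemma prov_taut2:
  "prov G X \<Longrightarrow> prov G Y \<Longrightarrow> tautology (X \<^bold>\<rightarrow> Y \<^bold>\<rightarrow> Z) \<Longrightarrow> prov G Z"
  by (meson GR_circ_taut prov.mp prov.base)

lemma prov_axiom_mp: "GR_axiom (X \<^bold>\<rightarrow> Y) \<Longrightarrow> prov G X \<Longrightarrow> prov G Y"
  by (meson GR_circ.ax prov.mp prov.base)

lemma prov_mono: "prov G X \<Longrightarrow> G \<subseteq> H \<Longrightarrow> prov H X"
  by (induction rule: prov.induct) (auto intro: prov.intros)

lemma prov_compact: "prov G X \<Longrightarrow> \<exists>H. finite H \<and> H \<subseteq> G \<and> prov H X"
proof (induction rule: prov.induct)
  case (base X)
  then show ?case by (intro exI[of _ "{}"]) (auto intro: prov.base)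
next
  case (hyp X)
  then show ?case by (intro exI[of _ "{X}"]) (auto intro: prov.hyp)
next
  case (mp X Y)
  then obtain H K where "finite H" "H \<subseteq> G" "prov H (X \<^bold>\<rightarrow> Y)" "finite K" "K \<subseteq> G" "prov K X"
    by blast
  then show ?case
    by (intro exI[of _ "H \<union> K"]) (auto intro!: prov.mp[of _ X Y] elim: prov_mono)
qed

lemma prov_deduct: "prov (insert X G) Y \<Longrightarrow> prov G (X \<^bold>\<rightarrow> Y)"
proof (induction rule: prov.induct)
  case (base Y)
  then show ?case by (intro prov_taut1[OF prov.base[OF base]]) (simp add: tautology_def)
next
  case (hyp Y)
  show ?case
  proof (cases "Y = X")
    case True
    then show ?thesis by (intro prov.base GR_circ_taut) (simp add: tautology_def)
  next
    case False
    with hyp have "prov G Y" by (auto intro: prov.hyp)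
    then show ?thesis by (rule prov_taut1) (simp add: tautology_def)
  qed
next
  case (mp Y Z)
  show ?case by (rule prov_taut2[OF mp(3,4)]) (auto simp: tautology_def)
qed

lemma prov_Box_mp: "prov G (Box (X \<^bold>\<rightarrow> Y)) \<Longrightarrow> prov G (Box X) \<Longrightarrow> prov G (Box Y)"
  by (meson GR_axiom.K prov.mp prov_axiom_mp)

lemma prov_Box: "prov G X \<Longrightarrow> (\<And>Y. Y \<in> G \<Longrightarrow> prov H (Box Y)) \<Longrightarrow> prov H (Box X)"
  by (induction rule: prov.induct) (auto intro: prov.base GR_circ.nec prov_Box_mp)

lemma prov_empty: "prov {} X \<Longrightarrow> GR_circ X"
  by (induction rule: prov.induct) (auto intro: GR_circ.mp)

section \<open>Maximal inseparable pairs\<close>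

text \<open>A pair of theories is coded as a set of formulas tagged with a side.\<close>

definition side :: "bool \<Rightarrow> (bool \<times> fm) set \<Rightarrow> fm set" where
  "side b W = {X. (b, X) \<in> W}"

lemma side_mono: "V \<subseteq> W \<Longrightarrow> side b V \<subseteq> side b W"
  by (auto simp: side_def)

lemma side_insert [simp]:
  "side b (insert (c, X) W) = (if b = c then insert X (side b W) else side b W)"
  by (auto simp: side_def)

lemma side_empty [simp]: "side b {} = {}"
  by (simp add: side_def)

locale two_sides =
  fixes F :: "bool \<Rightarrow> fm"
begin

text \<open>A separating formula is asserted by one side and refuted by the other, hence the flipped sign.\<close>

definition lang :: "bool \<Rightarrow> fm \<Rightarrow> bool" where
  "lang b C \<longleftrightarrow> (\<forall>s D. atomlike D \<longrightarrow> D \<in> subfms s C \<longrightarrow>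
     D \<in> subfms s (F b) \<and> D \<in> subfms (flip s) (F (\<not> b)))"

definition insep :: "(bool \<times> fm) set \<Rightarrow> bool" where
  "insep W \<longleftrightarrow> (\<forall>C. lang True C \<longrightarrow> prov (side True W) C \<longrightarrow> prov (side False W) (\<^bold>\<not> C) \<longrightarrow> False)"

lemma lang_Bot [simp]: "lang b Bot"
  and lang_Or: "lang b C \<Longrightarrow> lang b D \<Longrightarrow> lang b (C \<^bold>\<or> D)"
  and lang_Box: "lang b C \<Longrightarrow> lang b (Box C)"
  by (auto simp: lang_def atomlike_subfms_simps)

lemma lang_Neg: "lang (\<not> b) C \<Longrightarrow> lang b (\<^bold>\<not> C)"
  by (simp add: lang_def atomlike_subfms_simps) (metis flip_flip)

text \<open>Opposite signs on the two sides put every \<open>atomlike\<close> part where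
  \<open>lang\<close> wants it, by transitivity of signed subformulas.\<close>

lemma lang_signed_subfm:
  assumes "X \<in> subfms Plus (F b)" "X \<in> subfms Minus (F (\<not> b))"
  shows "lang b X"
  unfolding lang_def
proof (intro allI impI)
  fix s D assume "D \<in> subfms s X"
  then show "D \<in> subfms s (F b) \<and> D \<in> subfms (flip s) (F (\<not> b))"
    using subfms_transI[OF assms(1), of D] subfms_transI[OF assms(2), of D] by (cases s) auto
qed

text \<open>Passing to the negation of \<open>C\<close> exchanges the sides, so later arguments can
  work with an arbitrary side \<open>b\<close>.\<close>

lemma insepD:
  assumes "insep W" "lang b C" "prov (side b W) C" "prov (side (\<not> b) W) (\<^bold>\<not> C)"
  shows False
proof (cases b)
  case True
  with assms show ?thesis by (auto simp: insep_def)
next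
  case False
  have "prov (side False W) (\<^bold>\<not> (\<^bold>\<not> C))"
    using assms False by (auto intro: prov_taut1 simp: tautology_def)
  moreover have "lang True (\<^bold>\<not> C)" using assms False lang_Neg[of True] by simp
  ultimately show ?thesis using assms False by (auto simp: insep_def)
qed

lemma not_insepE:
  assumes "\<not> insep W"
  obtains C where "lang b C" "prov (side b W) C" "prov (side (\<not> b) W) (\<^bold>\<not> C)"
proof -
  obtain C where C: "lang True C" "prov (side True W) C" "prov (side False W) (\<^bold>\<not> C)"
    using assms by (auto simp: insep_def)
  show thesis
  proof (cases b)
    case True
    with C that show ?thesis by auto
  next
    case False
    have "prov (side True W) (\<^bold>\<not> (\<^bold>\<not> C))"
      using C by (auto intro: prov_taut1 simp: tautology_def)
    moreover have "lang False (\<^bold>\<not> C)" using C lang_Neg[of False] by simp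
    ultimately show ?thesis using C False that[of "\<^bold>\<not> C"] by auto
  qed
qed

definition world :: "(bool \<times> fm) set \<Rightarrow> bool" where
  "world W \<longleftrightarrow> insep W \<and> (\<forall>V. insep V \<longrightarrow> W \<subseteq> V \<longrightarrow> V = W)"

text \<open>Derivations are finite, so a separation of the union already occurs in one member of the
  chain.\<close>

lemma insep_chain:
  assumes "C \<noteq> {}" "subset.chain {W. insep W} C"
  shows "insep (\<Union>C)"
  unfolding insep_def
proof (intro allI impI)
  fix D assume D: "lang True D" "prov (side True (\<Union>C)) D" "prov (side False (\<Union>C)) (\<^bold>\<not> D)"
  obtain H K where HK: "finite H" "H \<subseteq> side True (\<Union>C)" "prov H D"
    "finite K" "K \<subseteq> side False (\<Union>C)" "prov K (\<^bold>\<not> D)"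
    using prov_compact D by meson
  have "finite (Pair True ` H \<union> Pair False ` K)" "Pair True ` H \<union> Pair False ` K \<subseteq> \<Union>C"
    using HK by (auto simp: side_def)
  then obtain W where W: "W \<in> C" "Pair True ` H \<union> Pair False ` K \<subseteq> W"
    using finite_subset_Union_chain[OF _ _ assms] by metis
  then have "H \<subseteq> side True W" "K \<subseteq> side False W" by (auto simp: side_def)
  then have "prov (side True W) D" "prov (side False W) (\<^bold>\<not> D)"
    using HK prov_mono by blast+
  moreover have "insep W" using W(1) assms(2) by (auto simp: subset.chain_def)
  ultimately show False using D by (auto simp: insep_def)
qed

lemma extend_to_world:
  assumes "insep W0"
  obtains W where "world W" "W0 \<subseteq> W"
proof -
  let ?S = "{W. insep W \<and> W0 \<subseteq> W}"
  have "\<exists>M\<in>?S. \<forall>X\<in>?S. M \<subseteq> X \<longrightarrow> X = M"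
  proof (rule subset_Zorn_nonempty)
    show "?S \<noteq> {}" using assms by auto
  next
    fix C assume C: "C \<noteq> {}" "subset.chain ?S C"
    then have "subset.chain {W. insep W} C" by (auto simp: subset.chain_def)
    with C insep_chain have "insep (\<Union>C)" by blast
    moreover have "W0 \<subseteq> \<Union>C" using C unfolding subset.chain_def by blast
    ultimately show "\<Union>C \<in> ?S" by simp
  qed
  then obtain W where W: "insep W" "W0 \<subseteq> W" "\<forall>V\<in>?S. W \<subseteq> V \<longrightarrow> V = W" by blast
  then have "world W" unfolding world_def by auto
  with W(2) show thesis by (rule that[rotated])
qed

lemma world_consistent:
  assumes "world W"
  shows "\<not> prov (side b W) Bot"
proof
  assume "prov (side b W) Bot"
  moreover have "prov (side (\<not> b) W) (\<^bold>\<not> Bot)"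
    by (intro prov.base GR_circ_taut) (simp add: tautology_def)
  ultimately show False using assms insepD[of W b Bot] by (auto simp: world_def)
qed

text \<open>If neither \<open>X\<close> nor its negation can be added, the two resulting separators
  have a disjunction that separates \<open>W\<close> itself.\<close>

lemma world_complete:
  assumes "world W" "X \<notin> side b W"
  shows "\<^bold>\<not> X \<in> side b W"
proof (rule ccontr)
  assume "\<^bold>\<not> X \<notin> side b W"
  then have sep: "\<not> insep (insert (b, X) W)" "\<not> insep (insert (b, \<^bold>\<not> X) W)"
    using assms unfolding world_def side_def by blast+
  obtain C where
    C: "lang b C" "prov (insert X (side b W)) C" "prov (side (\<not> b) W) (\<^bold>\<not> C)"
    using not_insepE[OF sep(1), of b] by simp metis
  obtain D where
    D: "lang b D" "prov (insert (\<^bold>\<not> X) (side b W)) D" "prov (side (\<not> b) W) (\<^bold>\<not> D)"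
    using not_insepE[OF sep(2), of b] by simp metis
  have "prov (side b W) (C \<^bold>\<or> D)"
    by (rule prov_taut2[OF prov_deduct[OF C(2)] prov_deduct[OF D(2)]]) (auto simp: tautology_def)
  moreover have "prov (side (\<not> b) W) (\<^bold>\<not> (C \<^bold>\<or> D))"
    by (rule prov_taut2[OF C(3) D(3)]) (auto simp: tautology_def)
  ultimately show False
    using assms lang_Or[OF C(1) D(1)] insepD[of W b "C \<^bold>\<or> D"] by (auto simp: world_def)
qed

lemma world_Neg: "world W \<Longrightarrow> \<^bold>\<not> X \<in> side b W \<longleftrightarrow> X \<notin> side b W"
proof (rule iffI)
  assume W: "world W" and N: "\<^bold>\<not> X \<in> side b W"
  show "X \<notin> side b W"
  proof
    assume "X \<in> side b W"
    then have "prov (side b W) Bot"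
      by (intro prov_taut2[OF prov.hyp[OF N] prov.hyp]) (auto simp: tautology_def)
    with W world_consistent show False by blast
  qed
qed (rule world_complete)

lemma world_closed: "world W \<Longrightarrow> prov (side b W) X \<Longrightarrow> X \<in> side b W"
proof (rule ccontr)
  assume W: "world W" and X: "prov (side b W) X" "X \<notin> side b W"
  have "prov (side b W) Bot"
    by (rule prov_taut2[OF prov.hyp[OF world_complete[OF W X(2)]] X(1)]) (auto simp: tautology_def)
  with W world_consistent show False by blast
qed

lemma world_axiom_mp: "world W \<Longrightarrow> GR_axiom (X \<^bold>\<rightarrow> Y) \<Longrightarrow> X \<in> side b W \<Longrightarrow> Y \<in> side b W"
  by (rule world_closed[OF _ prov_axiom_mp[OF _ prov.hyp]])

lemma world_Or: "world W \<Longrightarrow> X \<^bold>\<or> Y \<in> side b W \<longleftrightarrow> X \<in> side b W \<or> Y \<in> side b W"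
proof (rule iffI)
  assume W: "world W" and O: "X \<^bold>\<or> Y \<in> side b W"
  show "X \<in> side b W \<or> Y \<in> side b W"
  proof (cases "X \<in> side b W")
    case False
    then have "prov (side b W) Y"
      by (intro prov_taut2[OF prov.hyp[OF O] prov.hyp[OF world_complete[OF W]]])
        (auto simp: tautology_def)
    with W world_closed show ?thesis by blast
  qed simp
next
  assume W: "world W" and O: "X \<in> side b W \<or> Y \<in> side b W"
  then have "prov (side b W) (X \<^bold>\<or> Y)"
    by (auto intro: prov_taut1[OF prov.hyp, of X] prov_taut1[OF prov.hyp, of Y]
        simp: tautology_def)
  with W world_closed show "X \<^bold>\<or> Y \<in> side b W" by blast
qed

lemma world_common:
  assumes "world W" "lang b C" "C \<in> side b W"
  shows "C \<in> side (\<not> b) W"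
proof (rule ccontr)
  assume "C \<notin> side (\<not> b) W"
  then have "\<^bold>\<not> C \<in> side (\<not> b) W" by (rule world_complete[OF assms(1)])
  then show False using assms insepD[of W b C] by (auto simp: world_def intro: prov.hyp)
qed

text \<open>Transitivity comes from boxing \<open>BBox_Box\<close> and applying it to
  \<open>Box_Box_BBox\<close>.\<close>

lemma world_Box_Box: "world W \<Longrightarrow> Box X \<in> side b W \<Longrightarrow> Box (Box X) \<in> side b W"
proof (rule world_closed)
  assume "Box X \<in> side b W"
  then have "prov (side b W) (Box (BBox X))"
    by (intro prov_axiom_mp[OF GR_axiom.Box_Box_BBox] prov.hyp)
  moreover have "prov (side b W) (Box (BBox X \<^bold>\<rightarrow> Box X))"
    by (intro prov.base GR_circ.nec GR_circ.ax GR_axiom.BBox_Box)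
  ultimately show "prov (side b W) (Box (Box X))" by (rule prov_Box_mp[rotated])
qed

section \<open>The canonical model\<close>

text \<open>The negated formulas let a successor witness that \<open>Box (\<^bold>\<not> D)\<close> fails, which is needed
  to transfer \<open>Dia (BBox D) \<^bold>\<rightarrow> Dia D\<close> to dead ends.\<close>

definition demands :: "fm set" where
  "demands = (let S = (\<Union>b s. subfms s (F b)) in insert Bot (S \<union> Neg ` S))"

lemma finite_demands: "finite demands"
proof -
  have "finite (UNIV :: sign set)"
    by (rule finite_subset[of _ "{Plus, Minus}"]) (auto intro: sign.exhaust)
  then show ?thesis by (simp add: demands_def Let_def finite_subfms)
qed

lemma demandsI:
  "Bot \<in> demands"
  "X \<in> subfms s (F b) \<Longrightarrow> X \<in> demands"
  "X \<in> subfms s (F b) \<Longrightarrow> \<^bold>\<not> X \<in> demands"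
proof -
  show "Bot \<in> demands" by (simp add: demands_def Let_def)
next
  assume X: "X \<in> subfms s (F b)"
  show "X \<in> demands" using X unfolding demands_def Let_def by (intro insertI2 UnI1 UN_I) auto
  show "\<^bold>\<not> X \<in> demands"
    using X unfolding demands_def Let_def by (intro insertI2 UnI2 imageI UN_I) auto
qed

definition acc :: "(bool \<times> fm) set \<Rightarrow> (bool \<times> fm) set \<Rightarrow> bool" where
  "acc W V \<longleftrightarrow> world W \<and> world V \<and>
     (\<forall>b Y. Box Y \<in> side b W \<longrightarrow> Y \<in> side b V \<and> Box Y \<in> side b V) \<and>
     (\<exists>b. \<exists>X\<in>demands. Box X \<in> side b V \<and> Box X \<notin> side b W)"

lemma acc_world: "acc W V \<Longrightarrow> world W" "acc W V \<Longrightarrow> world V"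
  and acc_Box: "acc W V \<Longrightarrow> Box Y \<in> side b W \<Longrightarrow> Y \<in> side b V"
  by (auto simp: acc_def)

lemma acc_trans: "acc U V \<Longrightarrow> acc V W \<Longrightarrow> acc U W"
  unfolding acc_def by meson

text \<open>Boxed demands accumulate along \<open>acc\<close>, so the number of pairs of a side and
  a demand not yet boxed there drops strictly.\<close>

lemma wf_acc: "wf {(V, W). acc W V}"
proof -
  let ?B = "\<lambda>W. {(b, X). X \<in> demands \<and> Box X \<in> side b W}"
  let ?m = "\<lambda>W. card ((UNIV \<times> demands) - ?B W)"
  have "?m V < ?m W" if "acc W V" for V W
  proof (rule psubset_card_mono)
    show "finite ((UNIV \<times> demands) - ?B W)" using finite_demands by simp
    show "(UNIV \<times> demands) - ?B V \<subset> (UNIV \<times> demands) - ?B W"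
      using that unfolding acc_def by blast
  qed
  then have "{(V, W). acc W V} \<subseteq> measure ?m" by auto
  then show ?thesis using wf_subset wf_measure by blast
qed

text \<open>If \<open>C\<close> separated the seed \<open>?V\<close>, the box of its negation would
  lie in the other side of \<open>W\<close>. Being in the common language it would pass to side
  \<open>b\<close>, which would then satisfy the premise of Loeb's axiom and contain
  \<open>Box X\<close>.\<close>

lemma acc_witness:
  assumes W: "world W" and X: "X \<in> demands" "Box X \<notin> side b W"
  obtains V where "acc W V" "X \<notin> side b V"
proof -
  let ?U = "{(c, Y). Box Y \<in> side c W}"
  \<comment> \<open>\<open>Box X\<close> supplies the antecedent of the Loeb premise and is also the
    newly gained demand that \<open>acc\<close> requires.\<close>
  let ?V = "insert (b, Box X) (insert (b, \<^bold>\<not> X) ?U)"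
  have U: "prov (side c W) (Box Y)" if "prov (side c ?U) Y" for c Y
    using that by (rule prov_Box) (auto simp: side_def intro: prov.hyp)
  have "insep ?V"
  proof (rule ccontr)
    assume "\<not> insep ?V"
    then obtain C where C: "lang b C" "prov (insert (Box X) (insert (\<^bold>\<not> X) (side b ?U))) C"
      "prov (side (\<not> b) ?U) (\<^bold>\<not> C)"
      by (rule not_insepE[of _ b]) (auto split: if_splits)
    have "prov (side b ?U) (\<^bold>\<not> C \<^bold>\<rightarrow> (Box X \<^bold>\<rightarrow> X))"
      by (rule prov_taut1[OF prov_deduct[OF prov_deduct[OF C(2)]]]) (auto simp: tautology_def)
    note * = U[OF this]
    have "Box (\<^bold>\<not> C) \<notin> side b W"
    proof
      assume "Box (\<^bold>\<not> C) \<in> side b W"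
      then have "prov (side b W) (Box (Box X \<^bold>\<rightarrow> X))"
        by (intro prov_Box_mp[OF *] prov.hyp)
      then show False using X(2) W prov_axiom_mp[OF GR_axiom.Loeb] world_closed by blast
    qed
    moreover have "Box (\<^bold>\<not> C) \<in> side (\<not> b) W" using U[OF C(3)] world_closed[OF W] by blast
    moreover have "lang (\<not> b) (Box (\<^bold>\<not> C))" using C(1) lang_Neg[of "\<not> b" C] by (simp add: lang_Box)
    ultimately show False using world_common[OF W, of "\<not> b"] by auto
  qed
  then obtain V where V: "world V" "?V \<subseteq> V" by (rule extend_to_world)
  have sub: "side c ?V \<subseteq> side c V" for c using V(2) by (rule side_mono)
  have bV: "\<^bold>\<not> X \<in> side b V" "Box X \<in> side b V" using sub[of b] by auto
  have keep: "Y \<in> side c V" if "Box Y \<in> side c W" for c Y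
    using that V(2) by (auto simp: side_def)
  have "acc W V"
    unfolding acc_def using W V(1) X bV(2) keep world_Box_Box[OF W] by blast
  with that bV(1) V(1) world_Neg show thesis by blast
qed

section \<open>Dead ends and the valuation\<close>

abbreviation dead :: "(bool \<times> fm) set \<Rightarrow> bool" where
  "dead W \<equiv> \<forall>V. \<not> acc W V"

lemma dead_iff: "world W \<Longrightarrow> dead W \<longleftrightarrow> Box Bot \<in> side b W"
proof
  assume W: "world W" and "dead W"
  \<comment> \<open>\<open>Bot\<close> was put among the demands for this: a missing
    \<open>Box Bot\<close> yields a successor.\<close>
  then show "Box Bot \<in> side b W" using acc_witness[OF W demandsI(1)] by blast
next
  assume W: "world W" and B: "Box Bot \<in> side b W"
  show "dead W"
  proof (intro allI notI)
    fix V assume "acc W V"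
    with B have "prov (side b V) Bot" "world V" by (auto intro: prov.hyp acc_Box acc_world)
    with world_consistent show False by blast
  qed
qed

text \<open>A successor excludes \<open>Box Bot\<close>, leaving only the second disjunct of
  \<open>Box_Bot_BBox\<close>.\<close>

lemma live_BBox_iff:
  assumes "acc W V"
  shows "BBox X \<in> side b W \<longleftrightarrow> Box X \<in> side b W"
proof
  have W: "world W" using assms by (rule acc_world)
  show "BBox X \<in> side b W \<Longrightarrow> Box X \<in> side b W"
    by (rule world_axiom_mp[OF W GR_axiom.BBox_Box])
  assume "Box X \<in> side b W"
  then have "Box Bot \<^bold>\<or> BBox X \<in> side b W" by (rule world_axiom_mp[OF W GR_axiom.Box_Bot_BBox])
  then show "BBox X \<in> side b W" using world_Or[OF W] dead_iff[OF W, of b] assms by blast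
qed

text \<open>The last clause for \<open>BBox\<close> makes the rule \<open>bnec\<close> sound at isolated worlds; at other
  dead ends the clause about predecessors already does.\<close>

primrec val :: "(bool \<times> fm) set \<Rightarrow> fm \<Rightarrow> bool" where
  "val W (Var p) = (\<exists>b. Var p \<in> side b W \<and> Var p \<in> subfms Plus (F b))"
| "val W Bot = False"
| "val W (\<^bold>\<not> X) = (\<not> val W X)"
| "val W (X \<^bold>\<or> Y) = (val W X \<or> val W Y)"
| "val W (Box X) = (\<forall>V. acc W V \<longrightarrow> val V X)"
| "val W (BBox X) =
    (if dead W
     then (\<exists>b. BBox X \<in> side b W \<and> BBox X \<in> subfms Plus (F b)) \<or>
          (\<exists>U. acc U W \<and> (\<forall>V. acc U V \<longrightarrow> val V X)) \<or>
          (\<forall>U. \<not> acc U W) \<and> GR_circ X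
     else (\<forall>V. acc W V \<longrightarrow> val V X))"

lemma val_BBox_live: "acc W V \<Longrightarrow> val W (BBox X) \<longleftrightarrow> val W (Box X)"
  by auto

section \<open>Truth lemma\<close>

text \<open>A refuting side \<open>b\<close> and an asserting side \<open>c\<close> must differ; the
  formula then belongs to the common language, on which the two sides agree. This protects the
  stipulated truth of variables and of \<open>BBox\<close> formulas at dead ends.\<close>

lemma no_clash:
  assumes "world W" "X \<in> subfms Minus (F b)" "X \<notin> side b W"
  shows "\<not> (\<exists>c. X \<in> side c W \<and> X \<in> subfms Plus (F c))"
proof
  assume "\<exists>c. X \<in> side c W \<and> X \<in> subfms Plus (F c)"
  then obtain c where c: "X \<in> side c W" "X \<in> subfms Plus (F c)" by blast
  then have "c = (\<not> b)" using assms(3) by (cases b; cases c) auto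
  with c assms show False using lang_signed_subfm[of X c] world_common[of W c X] by auto
qed

lemma truth_lemma:
  "world W \<Longrightarrow> (X \<in> subfms Plus (F b) \<longrightarrow> X \<in> side b W \<longrightarrow> val W X) \<and>
   (X \<in> subfms Minus (F b) \<longrightarrow> X \<notin> side b W \<longrightarrow> \<not> val W X)"
proof (induction X arbitrary: W b)
  case (Var p)
  then show ?case using no_clash[of W "Var p" b] by auto
next
  case Bot
  then show ?case using world_consistent[of W b] by (auto intro: prov.hyp)
next
  case (Neg X)
  have "\<^bold>\<not> X \<in> subfms Plus (F b) \<Longrightarrow> X \<in> subfms Minus (F b)"
    "\<^bold>\<not> X \<in> subfms Minus (F b) \<Longrightarrow> X \<in> subfms Plus (F b)"
    using subfms_transI(2)[of "\<^bold>\<not> X" Plus "F b" X]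
      subfms_transI(2)[of "\<^bold>\<not> X" Minus "F b" X] by auto
  then show ?case using Neg.IH[OF Neg.prems, of b] world_Neg[OF Neg.prems, of X b] by auto
next
  case (Or X Y)
  have "X \<^bold>\<or> Y \<in> subfms s (F b) \<Longrightarrow> X \<in> subfms s (F b) \<and> Y \<in> subfms s (F b)" for s
    using subfms_transI(1)[of "X \<^bold>\<or> Y" s "F b" X] subfms_transI(1)[of "X \<^bold>\<or> Y" s "F b" Y]
    by auto
  then show ?case
    using Or.IH(1)[OF Or.prems, of b] Or.IH(2)[OF Or.prems, of b] world_Or[OF Or.prems, of X Y b]
    by auto
next
  case (Box X)
  have sub: "Box X \<in> subfms s (F b) \<Longrightarrow> X \<in> subfms s (F b)" for s
    using subfms_transI(1)[of "Box X" s "F b" X] by auto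
  show ?case
  proof (intro conjI impI)
    assume "Box X \<in> subfms Plus (F b)" "Box X \<in> side b W"
    then show "val W (Box X)" unfolding val.simps using sub Box.IH acc_Box acc_world(2) by blast
  next
    assume *: "Box X \<in> subfms Minus (F b)" "Box X \<notin> side b W"
    obtain V where "acc W V" "X \<notin> side b V"
      using acc_witness[OF Box.prems demandsI(2)[OF sub[OF *(1)]] *(2)] .
    then show "\<not> val W (Box X)" unfolding val.simps using sub[OF *(1)] Box.IH acc_world(2) by blast
  qed
next
  case (BBox X)
  have sub: "BBox X \<in> subfms s (F b) \<Longrightarrow> X \<in> subfms s (F b)" for s
    using subfms_transI(1)[of "BBox X" s "F b" X] by auto
  show ?case
  proof (intro conjI impI)
    assume *: "BBox X \<in> subfms Plus (F b)" "BBox X \<in> side b W"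
    show "val W (BBox X)"
    proof (cases "dead W")
      case True
      then show ?thesis using * by auto
    next
      case False
      then have "Box X \<in> side b W" using * live_BBox_iff by blast
      then have "\<forall>V. acc W V \<longrightarrow> val V X" using sub[OF *(1)] BBox.IH acc_Box acc_world(2) by blast
      with False show ?thesis using val_BBox_live by auto
    qed
  next
    assume *: "BBox X \<in> subfms Minus (F b)" "BBox X \<notin> side b W"
    \<comment> \<open>Kept general in \<open>U\<close>, since it is applied to \<open>W\<close> and
      to predecessors of \<open>W\<close>.\<close>
    have wit: "\<exists>V. acc U V \<and> \<not> val V X" if "world U" "Box X \<notin> side b U" for U
      using acc_witness[OF that(1) demandsI(2)[OF sub[OF *(1)]] that(2)] sub[OF *(1)]
        BBox.IH acc_world(2) by metis
    show "\<not> val W (BBox X)"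
    proof (cases "dead W")
      case True
      \<comment> \<open>The three ways for \<open>BBox X\<close> to hold at a dead end are excluded
        one by one.\<close>
      have "\<not> (\<exists>b. BBox X \<in> side b W \<and> BBox X \<in> subfms Plus (F b))"
        using no_clash[OF BBox.prems *] .
      moreover have "\<not> GR_circ X"
        using * world_closed[OF BBox.prems] by (auto intro: prov.base GR_circ.bnec)
      moreover have "\<not> (\<forall>V. acc U V \<longrightarrow> val V X)" if U: "acc U W" for U
      proof -
        \<comment> \<open>Otherwise \<open>U\<close> would contain \<open>Box (BBox X)\<close> and
          pass \<open>BBox X\<close> on to \<open>W\<close>.\<close>
        have "Box X \<notin> side b U"
          using *(2) U acc_Box world_axiom_mp[OF acc_world(1)[OF U] GR_axiom.Box_Box_BBox] by blast
        with U wit acc_world(1) show ?thesis by blast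
      qed
      ultimately show ?thesis using True by auto
    next
      case False
      then have "Box X \<notin> side b W" using * live_BBox_iff by blast
      with BBox.prems wit have "\<not> val W (Box X)" by auto
      with False show ?thesis using val_BBox_live by blast
    qed
  qed
qed

section \<open>Soundness of the model\<close>

lemma val_truth: "val W X = truth (val W) X"
  by (induction X) auto

lemma val_Loeb: "val W (Box (Box X \<^bold>\<rightarrow> X)) \<Longrightarrow> val W (Box X)"
proof -
  assume *: "val W (Box (Box X \<^bold>\<rightarrow> X))"
  have "acc W V \<longrightarrow> val V X" for V
    using wf_acc
  proof (induction V rule: wf_induct_rule)
    case (less V)
    then show ?case using * acc_trans by auto
  qed
  then show ?thesis by simp
qed

lemma val_BBox_forced:
  assumes "acc U W" "\<And>V. acc U V \<Longrightarrow> val V X"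
  shows "val W (BBox X)"
proof (cases "dead W")
  case True
  then show ?thesis using assms by auto
next
  case False
  then show ?thesis using assms acc_trans by auto
qed

text \<open>Semantic content of \<open>Dia_BBox\<close>. At a dead end a theory could demand
  \<open>BBox X\<close> only at a positive occurrence; the truth lemma then makes \<open>U\<close>
  contain the box of the negation of \<open>X\<close>, and the axiom inside \<open>U\<close> refutes
  \<open>BBox X\<close> at \<open>W\<close>.\<close>

lemma val_not_BBox_forced:
  assumes U: "acc U W" "\<And>V. acc U V \<Longrightarrow> \<not> val V X"
  shows "\<not> val W (BBox X)"
proof (cases "dead W")
  case True
  have "\<not> (BBox X \<in> side b W \<and> BBox X \<in> subfms Plus (F b))" for b
  proof
    assume *: "BBox X \<in> side b W \<and> BBox X \<in> subfms Plus (F b)"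
    then have X: "X \<in> subfms Plus (F b)" using subfms_transI(1)[of "BBox X" Plus "F b" X] by auto
    have wU: "world U" using U(1) by (rule acc_world)
    have "Box (\<^bold>\<not> X) \<in> side b U"
    proof (rule ccontr)
      assume "Box (\<^bold>\<not> X) \<notin> side b U"
      then obtain V where V: "acc U V" "\<^bold>\<not> X \<notin> side b V"
        using acc_witness[OF wU demandsI(3)[OF X]] by blast
      then have "X \<in> side b V" using world_complete acc_world(2) by blast
      with V U(2) X truth_lemma acc_world(2) show False by blast
    qed
    then have "Dia X \<notin> side b U" by (simp add: world_Neg[OF wU])
    then have "Dia (BBox X) \<notin> side b U" using world_axiom_mp[OF wU GR_axiom.Dia_BBox] by blast
    then have "Box (\<^bold>\<not> (BBox X)) \<in> side b U" by (simp add: world_Neg[OF wU])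
    then have "\<^bold>\<not> (BBox X) \<in> side b W" using U(1) acc_Box by blast
    with * show False using world_Neg[OF acc_world(2)[OF U(1)]] by blast
  qed
  \<comment> \<open>\<open>W\<close> is itself a successor of any such \<open>T\<close>, and
    \<open>X\<close> fails there.\<close>
  moreover have "\<not> (\<exists>T. acc T W \<and> (\<forall>V. acc T V \<longrightarrow> val V X))" using U by blast
  ultimately show ?thesis using True U(1) by auto
next
  case False
  then show ?thesis using U acc_trans by auto
qed

lemma val_bnec:
  assumes "GR_circ X" "\<And>V. val V X"
  shows "val W (BBox X)"
proof (cases "\<exists>U. acc U W")
  case True
  then show ?thesis using assms(2) val_BBox_forced by blast
next
  case False
  then show ?thesis using assms by simp
qed

lemma val_axiom: "GR_axiom X \<Longrightarrow> val W X"
proof (induction rule: GR_axiom.induct)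
  case (taut A)
  then show ?case using val_truth[of W A] by (simp add: tautology_def)
next
  case (Loeb A)
  then show ?case using val_Loeb[of W A] by (simp del: val.simps(5))
next
  case (BBox_Box A)
  then show ?case by auto
next
  case (Box_Box_BBox A)
  then show ?case using val_BBox_forced[of W _ A] by (auto simp del: val.simps(6))
next
  case (Dia_BBox A)
  then show ?case using val_not_BBox_forced[of W _ A] by (auto simp del: val.simps(6))
qed auto

lemma val_sound: "GR_circ X \<Longrightarrow> val W X"
proof (induction arbitrary: W rule: GR_circ.induct)
  case (mp A B)
  then show ?case using mp.IH(1)[of W] by simp
next
  case (bnec A)
  then show ?case by (intro val_bnec)
qed (auto intro: val_axiom)

end

section \<open>Interpolants as separators\<close>

lemma interpolation:
  assumes "GR_circ (A \<^bold>\<rightarrow> B)"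
  obtains C where "GR_circ (A \<^bold>\<rightarrow> C)" "GR_circ (C \<^bold>\<rightarrow> B)"
    "\<And>s D. atomlike D \<Longrightarrow> D \<in> subfms s C \<Longrightarrow> D \<in> subfms s A \<inter> subfms s B"
proof -
  \<comment> \<open>Negating \<open>B\<close> flips its signs, which undoes the \<open>flip\<close>
    in \<open>lang\<close>: a separator then has matching signs in \<open>A\<close> and
    \<open>B\<close>.\<close>
  define F where "F b = (if b then A else \<^bold>\<not> B)" for b
  interpret two_sides F .
  let ?W = "{(True, A), (False, \<^bold>\<not> B)}"
  \<comment> \<open>An inseparable pair would extend to a world refuting the given theorem.\<close>
  have "\<not> insep ?W"
  proof
    assume "insep ?W"
    then obtain W where W: "world W" "?W \<subseteq> W" by (rule extend_to_world)
    then have "A \<in> side True W" "\<^bold>\<not> B \<in> side False W" by (auto simp: side_def)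
    then have "val W A" "val W (\<^bold>\<not> B)"
      using truth_lemma[OF W(1), of A True] truth_lemma[OF W(1), of "\<^bold>\<not> B" False]
      by (auto simp: F_def)
    moreover have "val W (A \<^bold>\<rightarrow> B)" using assms by (rule val_sound)
    ultimately show False by simp
  qed
  then obtain C where C: "lang True C" "prov {A} C" "prov {\<^bold>\<not> B} (\<^bold>\<not> C)"
    using not_insepE[of ?W True] by auto
  show thesis
  proof
    show "GR_circ (A \<^bold>\<rightarrow> C)" using C(2) prov_deduct prov_empty by blast
    have "prov {} (C \<^bold>\<rightarrow> B)"
      by (rule prov_taut1[OF prov_deduct[OF C(3)]]) (auto simp: tautology_def)
    then show "GR_circ (C \<^bold>\<rightarrow> B)" by (rule prov_empty)
    show "D \<in> subfms s A \<inter> subfms s B" if "atomlike D" "D \<in> subfms s C" for s D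
      using that C(1) by (auto simp: lang_def F_def atomlike_subfms_simps)
  qed
qed

theorem theorem4p2:
  shows "lyndon_interpolation GR_circ \<and>
    (\<forall>A B. GR_circ (A \<^bold>\<rightarrow> B) \<longrightarrow>
      (\<exists>C. svars Plus C \<subseteq> svars Plus A \<inter> svars Plus B \<and>
           svars Minus C \<subseteq> svars Minus A \<inter> svars Minus B \<and>
           GR_circ (A \<^bold>\<rightarrow> C) \<and> GR_circ (C \<^bold>\<rightarrow> B) \<and>
           (\<forall>s D. BBox D \<in> subfms s C \<longrightarrow> BBox D \<in> subfms s A \<inter> subfms s B)))"
proof -
  have main: "\<exists>C. (\<forall>s. svars s C \<subseteq> svars s A \<inter> svars s B) \<and>
      GR_circ (A \<^bold>\<rightarrow> C) \<and> GR_circ (C \<^bold>\<rightarrow> B) \<and>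
      (\<forall>s D. BBox D \<in> subfms s C \<longrightarrow> BBox D \<in> subfms s A \<inter> subfms s B)"
    if AB: "GR_circ (A \<^bold>\<rightarrow> B)" for A B
  proof -
    obtain C where C: "GR_circ (A \<^bold>\<rightarrow> C)" "GR_circ (C \<^bold>\<rightarrow> B)"
      and sub: "\<And>s D. atomlike D \<Longrightarrow> D \<in> subfms s C \<Longrightarrow> D \<in> subfms s A \<inter> subfms s B"
      using interpolation[OF AB] by blast
    have "svars s C \<subseteq> svars s A \<inter> svars s B" for s
      using sub[of _ s] by (fastforce simp: svars_eq)
    moreover have "\<forall>s D. BBox D \<in> subfms s C \<longrightarrow> BBox D \<in> subfms s A \<inter> subfms s B"
      by (intro allI impI sub) simp_all
    ultimately show ?thesis using C by blast
  qed
  show ?thesis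
    unfolding lyndon_interpolation_def using main by (intro conjI allI impI) blast+
qed

end
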